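(* Let $(X,d)$ be a metric space, let $T:X\to X$ be a self-mapping, and let $r=\inf\{d(Tu,u): Tu\neq u,\ u\in X\}$. If $T$ is a Pata type $x_0$-mapping with $x_0\in X$, then $D[x_0,r]$ is a fixed disc of $T$, that is, $Tu=u$ for all $u\in D[x_0,r]$.
   Context: For $x_0\in X$ and $r\ge 0$, the disc is $D[x_0,r]=\{u\in X: d(u,x_0)\le r\}$. It is called a fixed disc of $T$ if $Tu=u$ for all $u\in D[x_0,r]$. $\Theta$ denotes the class of all increasing (i.e. nondecreasing) functions $\Psi:[0,1]\to[0,\infty)$ with $\Psi(0)=0$ (no continuity is required). Let $\Lambda\ge 0$, $\alpha\ge 1$ and $\beta\in[0,\alpha]$ be any constants. For $x_0\in X$, the self-mapping $T$ is called a Pata type $x_0$-mapping if there exists $\Psi\in\Theta$ such that for all $u\in X$ and each $\varepsilon\in[0,1]$, $$d(Tu,u)>0\Longrightarrow d(Tu,u)\le \frac{1-\varepsilon}{2}\|u\|+\Lambda\varepsilon^{\alpha}\Psi(\varepsilon)\left[1+\|u\|+\|Tu\|\right]^{\beta},$$ where $\|u\|=d(u,x_0)$. *)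

theory Defs
  imports "HOL-Analysis.Elementary_Metric_Spaces"
begin

(* Elements of the class are total functions on the reals; only their values on the
   unit interval are constrained. *)
definition Theta :: "(real \<Rightarrow> real) set" where
  "Theta = {\<Psi>. mono_on {0..1} \<Psi> \<and> (\<forall>t\<in>{0..1}. 0 \<le> \<Psi> t) \<and> \<Psi> 0 = 0}"

(* The norm of u is its distance to x0. Real exponents are rendered by powr; at eps = 0
   this gives 0 powr \<alpha> = 0, the usual value for \<alpha> > 0, and the base of the last power is
   at least 1. *)
definition pata_type ::
  "real \<Rightarrow> real \<Rightarrow> real \<Rightarrow> 'a::metric_space \<Rightarrow> ('a \<Rightarrow> 'a) \<Rightarrow> bool" where
  "pata_type \<Lambda> \<alpha> \<beta> x0 T \<longleftrightarrow>
     (\<exists>\<Psi>\<in>Theta. \<forall>u. \<forall>\<epsilon>\<in>{0..1}. dist (T u) u > 0 \<longrightarrow>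
        dist (T u) u \<le> (1 - \<epsilon>) / 2 * dist u x0
          + \<Lambda> * \<epsilon> powr \<alpha> * \<Psi> \<epsilon> * (1 + dist u x0 + dist (T u) x0) powr \<beta>)"

(* The radius is not required to be nonnegative: when it is Inf {dist (T u) u | u. T u \<noteq> u}
   this is automatic unless T = id, where Inf {} is unspecified and every disc is fixed. *)
definition fixed_disc :: "('a::metric_space \<Rightarrow> 'a) \<Rightarrow> 'a \<Rightarrow> real \<Rightarrow> bool" where
  "fixed_disc T x0 r \<longleftrightarrow> (\<forall>u\<in>cball x0 r. T u = u)"

end

theory Submission
  imports Defs
begin

text \<open>If a point \<open>u\<close> of the disc were moved, the Pata inequality at \<epsilon> =
  0 would give d(Tu,u) \<le> d(u,x0)/2 \<le> r/2. But r is the infimum of such displacements, so r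
  \<le> d(Tu,u). Hence d(Tu,u) \<le> d(Tu,u)/2, which is impossible for a positive number.\<close>

theorem theorem2p6:
  fixes T :: "'a::metric_space \<Rightarrow> 'a" and x0 :: 'a and \<Lambda> \<alpha> \<beta> r :: real
  assumes "\<Lambda> \<ge> 0" and "\<alpha> \<ge> 1" and "\<beta> \<in> {0..\<alpha>}"
    and "r = Inf {dist (T u) u | u. T u \<noteq> u}"
    and "pata_type \<Lambda> \<alpha> \<beta> x0 T"
  shows "fixed_disc T x0 r"
  unfolding fixed_disc_def
proof (intro ballI, rule ccontr)
  fix u assume u: "u \<in> cball x0 r" "T u \<noteq> u"
  \<comment> \<open>The case \<open>\<epsilon> = 0\<close> of the Pata condition, where the second summand vanishes.\<close>
  have "dist (T u) u \<le> dist u x0 / 2"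
    using assms(5) u(2) unfolding pata_type_def by force
  \<comment> \<open>Distances are bounded below by 0, so \<open>Inf\<close> is a genuine lower bound
    here.\<close>
  moreover have "r \<le> dist (T u) u"
    unfolding assms(4) using u(2) by (intro cInf_lower) (auto intro!: bdd_belowI[where m = 0])
  moreover have "dist u x0 \<le> r"
    using u(1) by (simp add: dist_commute)
  moreover have "dist (T u) u > 0"
    using u(2) by simp
  ultimately show False
    by linarith
qed

end
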